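(* For any family $\mathcal{F}$ of nonempty $3$-graphs, $\pi_{(1,2)-qr}(\mathcal{F})\le \pi_2(\mathcal{F})$.
   Context: For a set $A$, $A^{(k)}$ denotes the collection of all $k$-subsets of $A$. A $3$-graph is a pair $G=(V,E)$ with $V=V(G)$ a finite set of vertices and $E=E(G)\subseteq V^{(3)}$; $v(G)=|V(G)|$; $G$ is nonempty if it has at least one edge. A subgraph of $G$ is a $3$-graph $H$ with $V(H)\subseteq V(G)$ and $E(H)\subseteq E(G)$. $G$ is $\mathcal{F}$-free if it does not contain a copy of a member of $\mathcal{F}$ as a (not necessarily induced) subgraph. For a pair $S\in V(G)^{(2)}$, $\deg(S)$ is the number of edges of $G$ containing $S$, and $\delta_2(G)$ is the minimum of $\deg(S)$ over all $S\in V(G)^{(2)}$. $\mathrm{ex}_2(n,\mathcal{F})$ is the maximum of $\delta_2(G)$ over all $\mathcal{F}$-free $3$-graphs $G$ on $n$ vertices, and the codegree density is $\pi_2(\mathcal{F})=\lim_{n\to\infty}\mathrm{ex}_2(n,\mathcal{F})/(n-2)$ (this limit is known to exist). A $3$-graph $G$ is $(p,\varepsilon,(1,2))$-quasirandom if for every set of vertices $X\subseteq V(G)$ and every set of pairs $P\subseteq V(G)^{(2)}$, the number $e_{1,2}(X,P)$ of pairs $(x,uv)\in X\times P$ such that $\{x\}\cup\{u,v\}\in E(G)$ satisfies $\left| e_{1,2}(X,P)-p|X|\cdot|P| \right|\le \varepsilon v(G)^3$. A sequence $\mathbf{G}=(G_n)_{n\in\mathbb{N}}$ of $3$-graphs is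 a $(1,2)$-quasirandom sequence if $v(G_n)\to\infty$ as $n\to\infty$ and there are a constant $p\in[0,1]$ and a sequence of nonnegative reals $\varepsilon_n\to 0$ such that $G_n$ is $(p,\varepsilon_n,(1,2))$-quasirandom for each $n$; the density $\rho(\mathbf{G})$ of the sequence is the (supremum of all) $p$ for which this holds. Then $\pi_{(1,2)-qr}(\mathcal{F})$ is the supremum of $\rho(\mathbf{G})$ over all $(1,2)$-quasirandom sequences $\mathbf{G}$ of $\mathcal{F}$-free $3$-graphs. *)

theory Defs
  imports "HOL-Analysis.Analysis" "HOL-Library.Ramsey"
begin

(* nsets A k, from HOL-Library.Ramsey, is the set of all k-element subsets of A. *)

type_synonym 'a hypergraph = "'a set \<times> 'a set set"

abbreviation verts :: "'a hypergraph \<Rightarrow> 'a set" where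
  "verts G \<equiv> fst G"

abbreviation edges :: "'a hypergraph \<Rightarrow> 'a set set" where
  "edges G \<equiv> snd G"

definition three_graph :: "'a hypergraph \<Rightarrow> bool" where
  "three_graph G \<longleftrightarrow> finite (verts G) \<and> edges G \<subseteq> nsets (verts G) 3"

definition nonempty_graph :: "'a hypergraph \<Rightarrow> bool" where
  "nonempty_graph G \<longleftrightarrow> edges G \<noteq> {}"

definition subgraph_of :: "'a hypergraph \<Rightarrow> 'a hypergraph \<Rightarrow> bool" where
  "subgraph_of H G \<longleftrightarrow> three_graph H \<and> verts H \<subseteq> verts G \<and> edges H \<subseteq> edges G"

definition isomorphic :: "'a hypergraph \<Rightarrow> 'b hypergraph \<Rightarrow> bool" where
  "isomorphic F H \<longleftrightarrow>
    (\<exists>f. bij_betw f (verts F) (verts H) \<and> (\<lambda>e. f ` e) ` edges F = edges H)"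

definition free_of :: "'a hypergraph set \<Rightarrow> 'b hypergraph \<Rightarrow> bool" where
  "free_of \<F> G \<longleftrightarrow> \<not> (\<exists>F\<in>\<F>. \<exists>H. subgraph_of H G \<and> isomorphic F H)"

definition codeg :: "'a hypergraph \<Rightarrow> 'a set \<Rightarrow> nat" where
  "codeg G S = card {e \<in> edges G. S \<subseteq> e}"

(* Only meaningful for graphs with at least two vertices. *)
definition min_codeg :: "'a hypergraph \<Rightarrow> nat" where
  "min_codeg G = Min (codeg G ` nsets (verts G) 2)"

(* Host graphs live on vertices of type nat: every finite graph has an isomorphic copy there,
   and min_codeg, free_of and the quasirandomness below are invariant under isomorphism. *)
definition ex2 :: "nat \<Rightarrow> 'a hypergraph set \<Rightarrow> nat" where
  "ex2 n \<F> = Max {min_codeg G | G :: nat hypergraph.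
     three_graph G \<and> card (verts G) = n \<and> free_of \<F> G}"

definition codegree_density :: "'a hypergraph set \<Rightarrow> real" where
  "codegree_density \<F> = lim (\<lambda>n. real (ex2 n \<F>) / (real n - 2))"

definition e12 :: "'a hypergraph \<Rightarrow> 'a set \<Rightarrow> 'a set set \<Rightarrow> nat" where
  "e12 G X P = card {(x, S). x \<in> X \<and> S \<in> P \<and> {x} \<union> S \<in> edges G}"

definition quasirandom12 :: "real \<Rightarrow> real \<Rightarrow> 'a hypergraph \<Rightarrow> bool" where
  "quasirandom12 p \<epsilon> G \<longleftrightarrow>
    (\<forall>X P. X \<subseteq> verts G \<longrightarrow> P \<subseteq> nsets (verts G) 2 \<longrightarrow>
      \<bar>real (e12 G X P) - p * real (card X) * real (card P)\<bar> \<le> \<epsilon> * real (card (verts G)) ^ 3)"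

definition qr12_with_density :: "(nat \<Rightarrow> 'a hypergraph) \<Rightarrow> real \<Rightarrow> bool" where
  "qr12_with_density G p \<longleftrightarrow> p \<in> {0..1} \<and>
    (\<exists>\<epsilon>. (\<forall>n. 0 \<le> \<epsilon> n) \<and> \<epsilon> \<longlonglongrightarrow> 0 \<and> (\<forall>n. quasirandom12 p (\<epsilon> n) (G n)))"

definition qr12_sequence :: "(nat \<Rightarrow> 'a hypergraph) \<Rightarrow> bool" where
  "qr12_sequence G \<longleftrightarrow>
    (\<forall>n. three_graph (G n)) \<and>
    filterlim (\<lambda>n. card (verts (G n))) at_top sequentially \<and>
    (\<exists>p. qr12_with_density G p)"

definition seq_density :: "(nat \<Rightarrow> 'a hypergraph) \<Rightarrow> real" where
  "seq_density G = Sup {p. qr12_with_density G p}"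

definition qr12_density :: "'a hypergraph set \<Rightarrow> real" where
  "qr12_density \<F> = Sup {seq_density G | G :: nat \<Rightarrow> nat hypergraph.
     qr12_sequence G \<and> (\<forall>n. free_of \<F> (G n))}"

end

theory Submission
  imports Defs "HOL-Real_Asymp.Real_Asymp"
begin

text \<open>
  Let \<open>G\<close> be an \<open>\<F>\<close>-free 3-graph on \<open>N\<close> vertices in which all but a tiny proportion of the pairs
  have codegree at least \<open>a N\<close>. Pick \<open>m\<close> vertices of \<open>G\<close> at random, where \<open>m\<close> is large but fixed
  and \<open>N\<close> is much larger still. With high probability no pair of picked vertices is exceptional,
  and by a Chernoff bound the common neighbourhood of each picked pair contains at least
  \<open>(a - \<eta>) (m - 2)\<close> picked vertices: a given pair fails with probability at most
  \<open>exp (- \<eta>\<^sup>2 (m - 2) / 2)\<close>, and there are fewer than \<open>m\<^sup>2\<close> pairs. So \<open>G\<close> has an induced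
  subgraph on \<open>m\<close> vertices, again \<open>\<F>\<close>-free, of minimum codegree at least \<open>(a - \<eta>) (m - 2)\<close>.
  This is \<open>exists_induced_min_codeg\<close>; probabilities are expressed by counting maps
  \<open>{..<m} \<rightarrow> V(G)\<close>.

  A quasirandom 3-graph of density \<open>p\<close> has this property with \<open>a = p - \<eta>\<close>: if \<open>P\<close> is the set of
  pairs of codegree below \<open>(p - \<eta>) N\<close>, then \<open>e\<^sub>1\<^sub>,\<^sub>2(V, P)\<close>, the sum of these codegrees, falls short
  of \<open>p N |P|\<close> by at least \<open>\<eta> N |P|\<close>, whence \<open>\<eta> |P| \<le> \<epsilon> N\<^sup>2\<close>
  (\<open>card_low_pairs_quasirandom\<close>). Sampling then yields
  \<open>ex\<^sub>2(m, \<F>) / (m - 2) \<ge> p - 2 \<eta>\<close> for every large \<open>m\<close>.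

  The codegree density is defined as a limit, so the existence of this limit is part of the
  argument. It comes from the same sampling lemma, applied to extremal graphs: for large \<open>m\<close> and
  all much larger \<open>n\<close>, the ratio at \<open>n\<close> exceeds the ratio at \<open>m\<close> by at most \<open>\<eta>\<close>, and a bounded
  sequence with this property converges.
\<close>

section \<open>Sampling vertices with a Chernoff bound\<close>

text \<open>
  The coordinates of a uniformly random map \<open>I \<rightarrow> V\<close> are independent, also after conditioning on
  two of them. The case \<open>g = 1\<close> counts the maps with two prescribed values; exponential \<open>g\<close>
  gives the moment generating function needed for the tail bound.
\<close>

lemma sum_prod_PiE_fixed_pair:
  fixes g :: "'b \<Rightarrow> 'c::comm_semiring_1"
  assumes "finite I" "i \<in> I" "j \<in> I" "i \<noteq> j" "finite V" "u \<in> V" "v \<in> V"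
  shows "(\<Sum>f\<in>{f \<in> I \<rightarrow>\<^sub>E V. f i = u \<and> f j = v}. \<Prod>k\<in>I - {i, j}. g (f k))
           = (\<Sum>w\<in>V. g w) ^ (card I - 2)"
proof -
  define W where "W = (\<lambda>k. if k = i then {u} else if k = j then {v} else V)"
  define h where "h = (\<lambda>k w. if k = i \<or> k = j then 1 else g w)"
  have I: "I = insert i (insert j (I - {i, j}))" using assms by auto
  have split: "prod q I = q i * (q j * prod q (I - {i, j}))" for q :: "'a \<Rightarrow> 'c"
    using assms by (subst I) (simp del: insert_Diff_single)
  have fW: "finite (W k)" for k using assms by (simp add: W_def)
  have "{f \<in> I \<rightarrow>\<^sub>E V. f i = u \<and> f j = v} = Pi\<^sub>E I W"
    using assms by (auto simp: W_def PiE_iff extensional_def split: if_splits)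
  moreover have "(\<Prod>k\<in>I - {i, j}. g (f k)) = (\<Prod>k\<in>I. h k (f k))" for f
    by (subst split) (auto simp: h_def intro!: prod.cong)
  moreover have "(\<Sum>f\<in>Pi\<^sub>E I W. \<Prod>k\<in>I. h k (f k)) = (\<Prod>k\<in>I. \<Sum>w\<in>W k. h k w)"
    using assms fW by (simp add: prod_sum_PiE)
  moreover have "\<dots> = (\<Prod>k\<in>I - {i, j}. \<Sum>w\<in>V. g w)"
    by (subst split) (use assms in \<open>auto simp: h_def W_def intro!: prod.cong\<close>)
  moreover have "card (I - {i, j}) = card I - 2"
    using assms by (simp add: card_Diff_subset)
  ultimately show ?thesis by simp
qed

lemma exp_minus_le_quadratic:
  fixes x :: real
  assumes "0 \<le> x"
  shows "exp (- x) \<le> 1 - x + x\<^sup>2 / 2"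
proof -
  have "1 \<le> (1 - x + x\<^sup>2 / 2) * (1 + x + x\<^sup>2 / 2)"
  proof -
    have "(1 - x + x\<^sup>2 / 2) * (1 + x + x\<^sup>2 / 2) = 1 + x ^ 4 / 4"
      by (simp add: field_simps power2_eq_square power4_eq_xxxx)
    then show ?thesis by simp
  qed
  also have "\<dots> \<le> (1 - x + x\<^sup>2 / 2) * exp x"
  proof (intro mult_left_mono exp_lower_Taylor_quadratic assms)
    have "0 \<le> (1 - x)\<^sup>2 + 1" by simp
    then show "0 \<le> 1 - x + x\<^sup>2 / 2" by (simp add: power2_eq_square field_simps)
  qed
  finally show ?thesis by (simp add: exp_minus field_simps)
qed

text \<open>
  The lower tail of the binomial distribution, by the exponential moment method: a map that hits
  \<open>D\<close> fewer than \<open>(a - \<eta>) (|I| - 2)\<close> times has weight at least \<open>1\<close> under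
  \<open>f \<mapsto> exp (\<eta> ((a - \<eta>) (|I| - 2) - #hits))\<close>, and this weight factorises over the coordinates.
\<close>

lemma card_lower_tail_le:
  fixes a \<eta> :: real
  assumes I: "finite I" "i \<in> I" "j \<in> I" "i \<noteq> j"
    and V: "finite V" "u \<in> V" "v \<in> V"
    and a: "0 \<le> a" "a \<le> 1" and \<eta>: "0 < \<eta>"
    and D: "a * card V \<le> card (D \<inter> V)"
  shows "card {f \<in> I \<rightarrow>\<^sub>E V. f i = u \<and> f j = v \<and>
             real (card {k \<in> I - {i, j}. f k \<in> D}) < (a - \<eta>) * real (card I - 2)}
         \<le> real (card V) ^ (card I - 2) * exp (- (\<eta>\<^sup>2 / 2) * real (card I - 2))"
    (is "real (card ?X) \<le> _")
proof -
  define m where "m = card I - 2"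
  define N where "N = real (card V)"
  define g where "g = (\<lambda>w. exp (- \<eta> * of_bool (w \<in> D)))"
  let ?F = "{f \<in> I \<rightarrow>\<^sub>E V. f i = u \<and> f j = v}"
  have finF: "finite ?F"
    by (rule finite_subset[OF _ finite_PiE[of I "\<lambda>_. V"]]) (use I V in auto)
  have N: "0 \<le> N" by (simp add: N_def)
  have weight: "1 \<le> exp (\<eta> * ((a - \<eta>) * m)) * (\<Prod>k\<in>I - {i, j}. g (f k))" if "f \<in> ?X" for f
  proof -
    have "(\<Prod>k\<in>I - {i, j}. g (f k)) = exp (\<Sum>k\<in>I - {i, j}. - \<eta> * of_bool (f k \<in> D))"
      using I by (simp add: g_def exp_sum)
    also have "(\<Sum>k\<in>I - {i, j}. - \<eta> * of_bool (f k \<in> D)) = - \<eta> * card {k \<in> I - {i, j}. f k \<in> D}"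
      using I by (simp add: sum_distrib_left[symmetric] Int_def sum_negf)
    finally have "exp (\<eta> * ((a - \<eta>) * m)) * (\<Prod>k\<in>I - {i, j}. g (f k))
        = exp (\<eta> * ((a - \<eta>) * m - card {k \<in> I - {i, j}. f k \<in> D}))"
      by (simp add: right_diff_distrib exp_diff exp_minus divide_inverse)
    moreover have "0 \<le> (a - \<eta>) * m - card {k \<in> I - {i, j}. f k \<in> D}"
      using that by (simp add: m_def)
    ultimately show ?thesis using \<eta> by simp
  qed
  have "real (card ?X) = (\<Sum>f\<in>?X. 1)" by simp
  also have "\<dots> \<le> (\<Sum>f\<in>?X. exp (\<eta> * ((a - \<eta>) * m)) * (\<Prod>k\<in>I - {i, j}. g (f k)))"
    using weight by (intro sum_mono)
  also have "\<dots> \<le> (\<Sum>f\<in>?F. exp (\<eta> * ((a - \<eta>) * m)) * (\<Prod>k\<in>I - {i, j}. g (f k)))"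
    using finF by (intro sum_mono2) (auto simp: g_def intro!: mult_nonneg_nonneg prod_nonneg)
  also have "\<dots> = exp (\<eta> * ((a - \<eta>) * m)) * (\<Sum>w\<in>V. g w) ^ m"
    using sum_prod_PiE_fixed_pair[OF I V, of g] by (simp add: sum_distrib_left[symmetric] m_def)
  also have "\<dots> \<le> exp (\<eta> * ((a - \<eta>) * m)) * (N * exp (- a * \<eta> + \<eta>\<^sup>2 / 2)) ^ m"
  proof (intro mult_left_mono power_mono)
    have "(\<Sum>w\<in>V. g w) = (\<Sum>w\<in>V. 1 - (1 - exp (- \<eta>)) * of_bool (w \<in> D))"
      by (intro sum.cong) (auto simp: g_def)
    also have "\<dots> = N - (1 - exp (- \<eta>)) * card (D \<inter> V)"
      using V by (simp add: sum_subtractf sum_distrib_left[symmetric] N_def Int_commute Int_def)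
    also have "\<dots> \<le> N - (1 - exp (- \<eta>)) * (a * N)"
      using D \<eta> unfolding N_def by (intro diff_left_mono mult_left_mono) auto
    also have "\<dots> = N * (1 + - a * (1 - exp (- \<eta>)))" by (simp add: algebra_simps)
    also have "\<dots> \<le> N * exp (- a * (1 - exp (- \<eta>)))"
      using N by (intro mult_left_mono exp_ge_add_one_self)
    also have "\<dots> \<le> N * exp (- a * \<eta> + \<eta>\<^sup>2 / 2)"
    proof -
      have "a * (\<eta> - \<eta>\<^sup>2 / 2) \<le> a * (1 - exp (- \<eta>))"
        using exp_minus_le_quadratic[of \<eta>] \<eta> a by (intro mult_left_mono) auto
      moreover have "a * (\<eta>\<^sup>2 / 2) \<le> 1 * (\<eta>\<^sup>2 / 2)"
        using a by (intro mult_right_mono) auto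
      ultimately have "- a * (1 - exp (- \<eta>)) \<le> - a * \<eta> + \<eta>\<^sup>2 / 2" by (simp add: algebra_simps)
      then show ?thesis using N by (intro mult_left_mono) auto
    qed
    finally show "(\<Sum>w\<in>V. g w) \<le> N * exp (- a * \<eta> + \<eta>\<^sup>2 / 2)" .
  qed (auto simp: g_def intro: sum_nonneg)
  also have "\<dots> = N ^ m * exp (\<eta> * ((a - \<eta>) * m) + m * (- a * \<eta> + \<eta>\<^sup>2 / 2))"
    by (simp add: power_mult_distrib exp_of_nat_mult exp_add)
  also have "\<eta> * ((a - \<eta>) * m) + m * (- a * \<eta> + \<eta>\<^sup>2 / 2) = - (\<eta>\<^sup>2 / 2) * m"
    by (simp add: algebra_simps power2_eq_square)
  finally show ?thesis by (simp add: N_def m_def)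
qed

text \<open>
  A union bound over the ordered pairs \<open>(i, j)\<close> of coordinates. The two ways to fail, a forbidden
  pair of values and too few hits in the associated set, contribute the summands \<open>\<delta>\<close> and
  \<open>exp (- \<eta>\<^sup>2 (m - 2) / 2)\<close>.
\<close>

lemma exists_sample:
  fixes a \<eta> \<delta> :: real and D :: "'b \<Rightarrow> 'b \<Rightarrow> 'b set"
  assumes V: "finite V" "V \<noteq> {}"
    and a: "0 \<le> a" "a \<le> 1" and \<eta>: "0 < \<eta>"
    and m: "2 \<le> m"
    and B: "B \<subseteq> V \<times> V" "card B \<le> \<delta> * (card V)\<^sup>2"
    and D: "\<And>u v. u \<in> V \<Longrightarrow> v \<in> V \<Longrightarrow> (u, v) \<notin> B \<Longrightarrow> a * card V \<le> card (D u v \<inter> V)"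
    and small: "(real m)\<^sup>2 * (\<delta> + exp (- (\<eta>\<^sup>2 / 2) * real (m - 2))) < 1"
  obtains f where "f \<in> {..<m} \<rightarrow>\<^sub>E V"
    and "\<And>i j. i < m \<Longrightarrow> j < m \<Longrightarrow> i \<noteq> j \<Longrightarrow> (f i, f j) \<notin> B"
    and "\<And>i j. i < m \<Longrightarrow> j < m \<Longrightarrow> i \<noteq> j \<Longrightarrow>
           (a - \<eta>) * real (m - 2) \<le> card {k. k < m \<and> f k \<in> D (f i) (f j)}"
proof -
  define N where "N = real (card V)"
  have N: "N > 0" using V by (simp add: N_def card_gt_0_iff)
  define \<Omega> where "\<Omega> = {..<m} \<rightarrow>\<^sub>E V"
  define few where "few = (\<lambda>f i j u v. real (card {k \<in> {..<m} - {i, j}. f k \<in> D u v})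
                                           < (a - \<eta>) * real (m - 2))"
  define bad where "bad = (\<lambda>i j. {f \<in> \<Omega>. (f i, f j) \<in> B \<or> few f i j (f i) (f j)})"
  define e where "e = exp (- (\<eta>\<^sup>2 / 2) * real (m - 2))"
  have fin\<Omega>: "finite \<Omega>" using V by (auto simp: \<Omega>_def intro: finite_PiE)
  have finB: "finite B" using B V finite_subset by blast
  have card\<Omega>: "real (card \<Omega>) = N ^ m" by (simp add: \<Omega>_def card_PiE N_def)
  have Nm: "N\<^sup>2 * N ^ (m - 2) = N ^ m"
    using m by (metis le_add_diff_inverse power_add)
  \<comment> \<open>Condition on the values \<open>u\<close>, \<open>v\<close> at \<open>i\<close>, \<open>j\<close>: all maps count if \<open>(u, v)\<close> is in \<open>B\<close>,
    and only those in the lower tail otherwise.\<close>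
  have bad: "real (card (bad i j)) \<le> (\<delta> + e) * N ^ m" if ij: "i < m" "j < m" "i \<noteq> j" for i j
  proof -
    define X where "X = (\<lambda>(u, v). {f \<in> \<Omega>. f i = u \<and> f j = v})"
    define Y where "Y = (\<lambda>(u, v). {f \<in> \<Omega>. f i = u \<and> f j = v \<and> few f i j u v})"
    have X: "real (card (X q)) = N ^ (m - 2)" if "q \<in> V \<times> V" for q
      using that ij V sum_prod_PiE_fixed_pair[of "{..<m}" i j V "fst q" "snd q" "\<lambda>_. 1::real"]
      by (auto simp: X_def \<Omega>_def N_def split: prod.splits)
    have Y: "real (card (Y q)) \<le> N ^ (m - 2) * e" if "q \<in> V \<times> V - B" for q
      using that ij V a \<eta> D
        card_lower_tail_le[of "{..<m}" i j V "fst q" "snd q" a \<eta> "D (fst q) (snd q)"]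
      by (auto simp: Y_def \<Omega>_def few_def N_def e_def split: prod.splits)
    have sub: "bad i j \<subseteq> (\<Union>q\<in>B. X q) \<union> (\<Union>q\<in>V \<times> V - B. Y q)"
      using ij by (auto simp: bad_def X_def Y_def \<Omega>_def PiE_iff)
    have "card (bad i j) \<le> card ((\<Union>q\<in>B. X q) \<union> (\<Union>q\<in>V \<times> V - B. Y q))"
      using finB V fin\<Omega> by (intro card_mono sub) (auto simp: X_def Y_def)
    also have "\<dots> \<le> (\<Sum>q\<in>B. card (X q)) + (\<Sum>q\<in>V \<times> V - B. card (Y q))"
      using finB V by (intro order.trans[OF card_Un_le] add_mono card_UN_le) auto
    finally have "real (card (bad i j)) \<le> (\<Sum>q\<in>B. real (card (X q))) + (\<Sum>q\<in>V \<times> V - B. real (card (Y q)))"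
      by (simp flip: of_nat_sum of_nat_add)
    also have "\<dots> \<le> (\<Sum>q\<in>B. N ^ (m - 2)) + (\<Sum>q\<in>V \<times> V - B. N ^ (m - 2) * e)"
      using X Y B by (intro add_mono sum_mono) (auto intro: eq_refl)
    also have "\<dots> \<le> \<delta> * N\<^sup>2 * N ^ (m - 2) + N\<^sup>2 * (N ^ (m - 2) * e)"
    proof (intro add_mono)
      have "card (V \<times> V - B) \<le> card (V \<times> V)" using V by (intro card_mono) auto
      then have "real (card (V \<times> V - B)) \<le> N\<^sup>2"
        by (simp add: N_def power2_eq_square card_cartesian_product flip: of_nat_mult)
      then show "(\<Sum>q\<in>V \<times> V - B. N ^ (m - 2) * e) \<le> N\<^sup>2 * (N ^ (m - 2) * e)"
        using N by (simp add: e_def mult_right_mono)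
      show "(\<Sum>q\<in>B. N ^ (m - 2)) \<le> \<delta> * N\<^sup>2 * N ^ (m - 2)"
        using N B by (simp add: N_def mult_right_mono)
    qed
    also have "\<dots> = (\<delta> + e) * (N\<^sup>2 * N ^ (m - 2))" by (simp add: algebra_simps)
    finally show ?thesis by (simp add: Nm)
  qed
  define Q where "Q = {(i, j). i < m \<and> j < m \<and> i \<noteq> j}"
  have Q: "Q \<subseteq> {..<m} \<times> {..<m}" by (auto simp: Q_def)
  then have finQ: "finite Q" by (rule finite_subset) auto
  have cardQ: "card Q \<le> m\<^sup>2"
    using card_mono[OF _ Q] by (simp add: power2_eq_square)
  have "0 \<le> \<delta> + e"
  proof -
    have "0 \<le> \<delta> * (card V)\<^sup>2" using B(2) by (meson of_nat_0_le_iff order.trans)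
    then have "0 \<le> \<delta>" using N by (auto simp: N_def zero_le_mult_iff)
    then show ?thesis by (simp add: e_def)
  qed
  have "real (card (\<Union>q\<in>Q. bad (fst q) (snd q))) \<le> (\<Sum>q\<in>Q. real (card (bad (fst q) (snd q))))"
    using card_UN_le[OF finQ, of "\<lambda>q. bad (fst q) (snd q)"] by (simp flip: of_nat_sum)
  also have "\<dots> \<le> (\<Sum>q\<in>Q. (\<delta> + e) * N ^ m)"
    by (intro sum_mono bad) (auto simp: Q_def)
  also have "\<dots> \<le> real (m\<^sup>2) * ((\<delta> + e) * N ^ m)"
    using cardQ \<open>0 \<le> \<delta> + e\<close> N by (simp add: mult_right_mono flip: of_nat_power)
  also have "\<dots> = (m\<^sup>2 * (\<delta> + e)) * N ^ m" by simp
  also have "\<dots> < 1 * N ^ m"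
    using small N unfolding e_def by (intro mult_strict_right_mono) auto
  finally have "card (\<Union>q\<in>Q. bad (fst q) (snd q)) < card \<Omega>"
    using card\<Omega> by simp
  then have "\<not> \<Omega> \<subseteq> (\<Union>q\<in>Q. bad (fst q) (snd q))"
    using finQ fin\<Omega> by (auto simp: bad_def linorder_not_less[symmetric] dest: card_mono[rotated])
  then obtain f where f: "f \<in> \<Omega>" "f \<notin> (\<Union>q\<in>Q. bad (fst q) (snd q))" by blast
  show ?thesis
  proof
    show "f \<in> {..<m} \<rightarrow>\<^sub>E V" using f by (simp add: \<Omega>_def)
    fix i j assume ij: "i < m" "j < m" "i \<noteq> j"
    then have nb: "f \<notin> bad i j" using f(2) by (auto simp: Q_def)
    then show "(f i, f j) \<notin> B" using f(1) by (auto simp: bad_def)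
    have "(a - \<eta>) * real (m - 2) \<le> card {k \<in> {..<m} - {i, j}. f k \<in> D (f i) (f j)}"
      using nb f(1) by (auto simp: bad_def few_def)
    also have "\<dots> \<le> card {k. k < m \<and> f k \<in> D (f i) (f j)}"
      by (auto intro!: card_mono)
    finally show "(a - \<eta>) * real (m - 2) \<le> card {k. k < m \<and> f k \<in> D (f i) (f j)}" .
  qed
qed

section \<open>Codegrees and induced subgraphs\<close>

lemma codeg_eq_card_neighbours:
  assumes "three_graph G" "u \<noteq> v"
  shows "codeg G {u, v} = card {w \<in> verts G. {u, v, w} \<in> edges G}"
proof -
  have sub: "e \<in> edges G \<Longrightarrow> e \<subseteq> verts G \<and> card e = 3" for e
    using assms by (auto simp: three_graph_def nsets_def)
  have "inj_on (\<lambda>w. {u, v, w}) {w \<in> verts G. {u, v, w} \<in> edges G}"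
  proof (rule inj_onI)
    fix w w' assume "w \<in> {w \<in> verts G. {u, v, w} \<in> edges G}" "w' \<in> {w \<in> verts G. {u, v, w} \<in> edges G}"
      and eq: "{u, v, w} = {u, v, w'}"
    then have "card {u, v, w} = 3" "card {u, v, w'} = 3" using sub by auto
    then have "w \<notin> {u, v}" "w' \<notin> {u, v}" using assms(2) by (auto simp: card_insert_if split: if_splits)
    then show "w = w'" using eq by auto
  qed
  moreover have "(\<lambda>w. {u, v, w}) ` {w \<in> verts G. {u, v, w} \<in> edges G} = {e \<in> edges G. {u, v} \<subseteq> e}"
  proof (intro equalityI subsetI)
    fix e assume "e \<in> {e \<in> edges G. {u, v} \<subseteq> e}"
    then have e: "e \<in> edges G" "{u, v} \<subseteq> e" by auto
    then have "card (e - {u, v}) = 1"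
      using sub[of e] assms(2) by (simp add: card_Diff_subset)
    then obtain w where "e - {u, v} = {w}" by (auto simp: card_1_singleton_iff)
    then have "e = {u, v, w}" using e by auto
    then show "e \<in> (\<lambda>w. {u, v, w}) ` {w \<in> verts G. {u, v, w} \<in> edges G}"
      using e sub[of e] by auto
  qed auto
  ultimately show ?thesis
    unfolding codeg_def using card_image[of "\<lambda>w. {u, v, w}"] by fastforce
qed

lemma codeg_le:
  assumes "three_graph G" "u \<in> verts G" "v \<in> verts G" "u \<noteq> v"
  shows "codeg G {u, v} \<le> card (verts G) - 2"
proof -
  have "{w \<in> verts G. {u, v, w} \<in> edges G} \<subseteq> verts G - {u, v}"
  proof
    fix w assume w: "w \<in> {w \<in> verts G. {u, v, w} \<in> edges G}"
    then have "card {u, v, w} = 3"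
      using assms by (auto simp: three_graph_def nsets_def)
    then show "w \<in> verts G - {u, v}"
      using w assms(4) by (auto simp: card_insert_if split: if_splits)
  qed
  then have "card {w \<in> verts G. {u, v, w} \<in> edges G} \<le> card (verts G - {u, v})"
    using assms by (intro card_mono) (auto simp: three_graph_def)
  then show ?thesis
    using assms by (simp add: codeg_eq_card_neighbours card_Diff_subset)
qed

lemma min_codeg_attained:
  assumes "three_graph G" "2 \<le> card (verts G)"
  obtains u v where "u \<in> verts G" "v \<in> verts G" "u \<noteq> v" "min_codeg G = codeg G {u, v}"
proof -
  have "finite (verts G)" using assms by (simp add: three_graph_def)
  then have "min_codeg G \<in> codeg G ` nsets (verts G) 2"
    unfolding min_codeg_def using assms
    by (intro Min_in) (auto simp: nsets_eq_empty_iff finite_imp_finite_nsets)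
  then show ?thesis by (auto simp: nsets_2_eq intro: that)
qed

lemma min_codeg_le_codeg:
  assumes "three_graph G" "u \<in> verts G" "v \<in> verts G" "u \<noteq> v"
  shows "min_codeg G \<le> codeg G {u, v}"
  using assms unfolding min_codeg_def three_graph_def
  by (intro Min_le) (auto simp: finite_imp_finite_nsets nsets_2_eq)

definition induced :: "'a hypergraph \<Rightarrow> 'a set \<Rightarrow> 'a hypergraph" where
  "induced G S = (S, {e \<in> edges G. e \<subseteq> S})"

lemma three_graph_induced:
  assumes "three_graph G" "S \<subseteq> verts G"
  shows "three_graph (induced G S)"
  using assms by (auto simp: three_graph_def induced_def nsets_def intro: finite_subset)

lemma free_of_induced:
  assumes "free_of \<F> G" "S \<subseteq> verts G"
  shows "free_of \<F> (induced G S)"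
  using assms by (auto simp: free_of_def subgraph_of_def induced_def) blast

text \<open>
  The diagonal is included so that a sample avoiding all low pairs automatically consists of
  distinct vertices; it is only a \<open>1 / N\<close> fraction of the ordered pairs.
\<close>

definition low_pairs :: "real \<Rightarrow> 'a hypergraph \<Rightarrow> ('a \<times> 'a) set" where
  "low_pairs d G = {(u, v). u \<in> verts G \<and> v \<in> verts G \<and> (u = v \<or> real (codeg G {u, v}) < d)}"

text \<open>
  The sampling lemma for graphs: the forbidden pairs are the low pairs, and the set associated with
  a pair is its common neighbourhood.
\<close>

lemma exists_induced_min_codeg:
  fixes a \<eta> \<delta> :: real
  assumes G: "three_graph G" "verts G \<noteq> {}"
    and a: "0 \<le> a" "a \<le> 1" and \<eta>: "0 < \<eta>" and m: "2 \<le> m"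
    and low: "card (low_pairs (a * card (verts G)) G) \<le> \<delta> * (card (verts G))\<^sup>2"
    and small: "(real m)\<^sup>2 * (\<delta> + exp (- (\<eta>\<^sup>2 / 2) * real (m - 2))) < 1"
  obtains S where "S \<subseteq> verts G" "card S = m"
    "(a - \<eta>) * real (m - 2) \<le> min_codeg (induced G S)"
proof -
  let ?V = "verts G" and ?B = "low_pairs (a * card (verts G)) G"
  define D where "D = (\<lambda>u v. {w \<in> ?V. {u, v, w} \<in> edges G})"
  have V: "finite ?V" using G by (simp add: three_graph_def)
  have B: "?B \<subseteq> ?V \<times> ?V" by (auto simp: low_pairs_def)
  have D: "a * card ?V \<le> card (D u v \<inter> ?V)" if "u \<in> ?V" "v \<in> ?V" "(u, v) \<notin> ?B" for u v
  proof -
    have "D u v \<inter> ?V = D u v" by (auto simp: D_def)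
    then show ?thesis
      using that codeg_eq_card_neighbours[OF G(1), of u v] by (auto simp: low_pairs_def D_def)
  qed
  obtain f where f: "f \<in> {..<m} \<rightarrow>\<^sub>E ?V"
    and notB: "\<And>i j. i < m \<Longrightarrow> j < m \<Longrightarrow> i \<noteq> j \<Longrightarrow> (f i, f j) \<notin> ?B"
    and many: "\<And>i j. i < m \<Longrightarrow> j < m \<Longrightarrow> i \<noteq> j \<Longrightarrow>
           (a - \<eta>) * real (m - 2) \<le> card {k. k < m \<and> f k \<in> D (f i) (f j)}"
    using exists_sample[where D = D, OF V G(2) a \<eta> m B low D small] by blast
  have fV: "f k \<in> ?V" if "k < m" for k using f that by auto
  have inj: "inj_on f {..<m}"
    using notB fV by (force simp: inj_on_def low_pairs_def)
  define S where "S = f ` {..<m}"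
  have S: "S \<subseteq> ?V" "card S = m" using fV inj by (auto simp: S_def card_image)
  show ?thesis
  proof
    have 3: "three_graph (induced G S)" using G(1) S(1) by (rule three_graph_induced)
    moreover have "2 \<le> card (verts (induced G S))" using S m by (simp add: induced_def)
    ultimately obtain x y where xy: "x \<in> S" "y \<in> S" "x \<noteq> y"
      and min: "min_codeg (induced G S) = codeg (induced G S) {x, y}"
      by (rule min_codeg_attained) (auto simp: induced_def)
    then obtain i j where ij: "i < m" "j < m" "i \<noteq> j" "x = f i" "y = f j"
      by (auto simp: S_def)
    have "codeg (induced G S) {x, y} = card {w \<in> S. {x, y, w} \<in> edges G}"
      using codeg_eq_card_neighbours[OF 3 xy(3)] xy
      by (simp add: induced_def conj_commute cong: conj_cong)
    also have "{w \<in> S. {x, y, w} \<in> edges G} = f ` {k. k < m \<and> f k \<in> D x y}"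
      using fV by (auto simp: S_def D_def)
    also have "card \<dots> = card {k. k < m \<and> f k \<in> D x y}"
      using inj by (intro card_image) (auto intro: inj_on_subset)
    finally show "(a - \<eta>) * real (m - 2) \<le> min_codeg (induced G S)"
      using many[OF ij(1-3)] min ij by simp
  qed (use S in auto)
qed

section \<open>The codegree density is a limit\<close>

definition codeg_values :: "nat \<Rightarrow> 'a hypergraph set \<Rightarrow> nat set" where
  "codeg_values n \<F> = {min_codeg G | G :: nat hypergraph.
     three_graph G \<and> card (verts G) = n \<and> free_of \<F> G}"

lemma codeg_values_le:
  assumes "2 \<le> n" "d \<in> codeg_values n \<F>"
  shows "d \<le> n - 2"
proof -
  obtain G :: "nat hypergraph" where G: "three_graph G" "card (verts G) = n" "d = min_codeg G"
    using assms by (auto simp: codeg_values_def)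
  then obtain u v where "u \<in> verts G" "v \<in> verts G" "u \<noteq> v" "d = codeg G {u, v}"
    using min_codeg_attained[of G] assms by metis
  then show ?thesis using codeg_le[OF G(1), of u v] G(2) by simp
qed

lemma finite_codeg_values:
  assumes "2 \<le> n"
  shows "finite (codeg_values n \<F>)"
  by (rule finite_subset[of _ "{..n - 2}"]) (use codeg_values_le[OF assms] in auto)

lemma edgeless_three_graph: "finite V \<Longrightarrow> three_graph (V, {})"
  by (simp add: three_graph_def)

text \<open>
  This is where it matters that the forbidden graphs have edges: it guarantees that there are
  \<open>\<F>\<close>-free graphs of every size, hence that the maximum and the supremum are over nonempty sets.
\<close>

lemma edgeless_free_of:
  assumes "\<forall>F\<in>\<F>. nonempty_graph F"
  shows "free_of \<F> (V, {})"
  using assms unfolding free_of_def subgraph_of_def isomorphic_def nonempty_graph_def by fastforce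

lemma ex2_mem_codeg_values:
  assumes "\<forall>F\<in>\<F>. nonempty_graph F" "2 \<le> n"
  shows "ex2 n \<F> \<in> codeg_values n \<F>"
proof -
  have "min_codeg ({..<n}, {}) \<in> codeg_values n \<F>"
    unfolding codeg_values_def using edgeless_three_graph edgeless_free_of[OF assms(1)]
    by (intro CollectI exI[of _ "({..<n}, {})"]) auto
  then show ?thesis
    using finite_codeg_values[OF assms(2), of \<F>] unfolding ex2_def codeg_values_def[symmetric]
    by (intro Max_in) auto
qed

lemma min_codeg_le_ex2:
  fixes G :: "nat hypergraph"
  assumes "three_graph G" "card (verts G) = n" "free_of \<F> G" "2 \<le> n"
  shows "min_codeg G \<le> ex2 n \<F>"
proof -
  have "min_codeg G \<in> codeg_values n \<F>" using assms unfolding codeg_values_def by blast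
  then show ?thesis
    unfolding ex2_def codeg_values_def[symmetric] by (intro Max_ge finite_codeg_values assms)
qed

definition ex2_ratio :: "'a hypergraph set \<Rightarrow> nat \<Rightarrow> real" where
  "ex2_ratio \<F> n = real (ex2 n \<F>) / (real n - 2)"

lemma ex2_ratio_bounds:
  assumes "\<forall>F\<in>\<F>. nonempty_graph F" "3 \<le> n"
  shows "0 \<le> ex2_ratio \<F> n" "ex2_ratio \<F> n \<le> 1"
proof -
  have "ex2 n \<F> \<le> n - 2"
    using assms(2) by (intro codeg_values_le[OF _ ex2_mem_codeg_values[OF assms(1)]]) auto
  then have "real (ex2 n \<F>) \<le> real n - 2" using assms(2) by linarith
  then show "0 \<le> ex2_ratio \<F> n" "ex2_ratio \<F> n \<le> 1"
    using assms(2) by (auto simp: ex2_ratio_def divide_simps)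
qed

lemma eventually_failure_probability_small:
  fixes \<eta> :: real
  assumes "0 < \<eta>"
  shows "\<forall>\<^sub>F m in sequentially.
           3 \<le> m \<and> (real m)\<^sup>2 * exp (- (\<eta>\<^sup>2 / 2) * real (m - 2)) < 1 / 2"
proof -
  have "((\<lambda>m. (real m)\<^sup>2 * exp (- (\<eta>\<^sup>2 / 2) * (real m - 2))) \<longlongrightarrow> 0) sequentially"
    using assms by real_asymp
  then have "\<forall>\<^sub>F m in sequentially. (real m)\<^sup>2 * exp (- (\<eta>\<^sup>2 / 2) * (real m - 2)) < 1 / 2"
    by (rule order_tendstoD) simp
  with eventually_ge_at_top[of 3] show ?thesis
    by eventually_elim (simp add: of_nat_diff)
qed

text \<open>
  A host graph of any size in which all but a fraction of order \<open>m\<^sup>-\<^sup>2\<close> of the pairs have relative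
  codegree at least \<open>a\<close> bounds the extremal number at the fixed size \<open>m\<close> from below. This is applied
  twice: to extremal graphs, where it makes the sequence of ratios converge, and to quasirandom
  graphs, where it compares their density with the limit.
\<close>

lemma ex2_ratio_ge_of_few_low_pairs:
  fixes G :: "nat hypergraph" and a \<eta> :: real
  assumes a: "0 \<le> a" "a \<le> 1" and \<eta>: "0 < \<eta>"
    and m: "3 \<le> m" "(real m)\<^sup>2 * exp (- (\<eta>\<^sup>2 / 2) * real (m - 2)) < 1 / 2"
    and G: "three_graph G" "verts G \<noteq> {}" and free: "free_of \<F> G"
    and low: "card (low_pairs (a * card (verts G)) G) \<le> 1 / (2 * (real m)\<^sup>2) * (card (verts G))\<^sup>2"
  shows "a - \<eta> \<le> ex2_ratio \<F> m"
proof -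
  have "(real m)\<^sup>2 * (1 / (2 * (real m)\<^sup>2)) = 1 / 2" using m(1) by simp
  then have small: "(real m)\<^sup>2 * (1 / (2 * (real m)\<^sup>2) + exp (- (\<eta>\<^sup>2 / 2) * real (m - 2))) < 1"
    using m(2) unfolding distrib_left by linarith
  obtain S where S: "S \<subseteq> verts G" "card S = m"
    "(a - \<eta>) * real (m - 2) \<le> min_codeg (induced G S)"
    by (rule exists_induced_min_codeg[OF G a \<eta> _ low small]) (use m in auto)
  have "min_codeg (induced G S) \<le> ex2 m \<F>"
    using min_codeg_le_ex2[OF three_graph_induced[OF G(1) S(1)] _ free_of_induced[OF free S(1)]] S m
    by (simp add: induced_def)
  then have "(a - \<eta>) * real (m - 2) \<le> ex2 m \<F>" using S(3) by linarith
  then show ?thesis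
    using m by (simp add: ex2_ratio_def field_simps of_nat_diff)
qed

lemma card_diagonal: "card {(u, v). u \<in> V \<and> v \<in> V \<and> u = v} = card V"
proof -
  have "{(u, v). u \<in> V \<and> v \<in> V \<and> u = v} = (\<lambda>u. (u, u)) ` V" by auto
  then show ?thesis by (simp add: card_image inj_on_def)
qed

text \<open>
  Sampling \<open>m\<close> vertices from an extremal graph on \<open>n\<close> vertices loses at most \<open>\<eta>\<close>; here the only
  low pairs are those on the diagonal.
\<close>

lemma eventually_ex2_ratio_le:
  assumes "\<forall>F\<in>\<F>. nonempty_graph F" "0 < \<eta>"
  shows "\<forall>\<^sub>F m in sequentially. \<forall>\<^sub>F n in sequentially. ex2_ratio \<F> n \<le> ex2_ratio \<F> m + \<eta>"
proof -
  have *: "\<forall>\<^sub>F n in sequentially. ex2_ratio \<F> n \<le> ex2_ratio \<F> m + \<eta>"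
    if m: "3 \<le> m" "(real m)\<^sup>2 * exp (- ((\<eta> / 2)\<^sup>2 / 2) * real (m - 2)) < 1 / 2" for m
  proof -
    define \<delta> where "\<delta> = 1 / (2 * (real m)\<^sup>2)"
    have \<delta>: "0 < \<delta>" using m by (simp add: \<delta>_def)
    have "\<forall>\<^sub>F n in sequentially. 3 \<le> n \<and> 4 / \<eta> \<le> real n \<and> 1 / \<delta> \<le> real n"
      using assms(2) \<delta> by (intro eventually_conj) real_asymp+
    then show ?thesis
    proof (rule eventually_mono)
      fix n assume n: "3 \<le> n \<and> 4 / \<eta> \<le> real n \<and> 1 / \<delta> \<le> real n"
      \<comment> \<open>Half of \<open>\<eta>\<close> is spent on sampling, the other half on passing from \<open>n - 2\<close> to \<open>n\<close> in
        the denominator.\<close>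
      define a where "a = max 0 (ex2_ratio \<F> n - \<eta> / 2)"
      obtain G :: "nat hypergraph" where G: "three_graph G" "card (verts G) = n" "free_of \<F> G"
        and min: "ex2 n \<F> = min_codeg G"
        using ex2_mem_codeg_values[OF assms(1), of n] n by (auto simp: codeg_values_def)
      have r: "0 \<le> ex2_ratio \<F> n" "ex2_ratio \<F> n \<le> 1" using ex2_ratio_bounds[OF assms(1)] n by auto
      have ex: "ex2 n \<F> = ex2_ratio \<F> n * (real n - 2)" using n by (simp add: ex2_ratio_def)
      have "(ex2_ratio \<F> n - \<eta> / 2) * real n \<le> ex2 n \<F>"
      proof -
        have "4 \<le> \<eta> * n" using n assms(2) by (simp add: field_simps)
        then show ?thesis unfolding ex using r by (simp add: algebra_simps)
      qed
      then have "a * real n \<le> ex2 n \<F>" by (simp add: a_def max_def)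
      then have "low_pairs (a * card (verts G)) G \<subseteq> {(u, v). u \<in> verts G \<and> v \<in> verts G \<and> u = v}"
        using min_codeg_le_codeg[OF G(1)] min G(2) by (fastforce simp: low_pairs_def)
      then have "card (low_pairs (a * card (verts G)) G) \<le> card {(u, v). u \<in> verts G \<and> v \<in> verts G \<and> u = v}"
        using G(1) by (intro card_mono) (auto simp: three_graph_def intro: finite_subset[of _ "verts G \<times> verts G"])
      then have "real (card (low_pairs (a * card (verts G)) G)) \<le> n"
        using G(2) by (simp add: card_diagonal)
      also have "real n \<le> \<delta> * (card (verts G))\<^sup>2"
        using n \<delta> G(2) by (simp add: power2_eq_square field_simps)
      finally have "a - \<eta> / 2 \<le> ex2_ratio \<F> m"
        using r G n assms(2) m unfolding \<delta>_def
        by (intro ex2_ratio_ge_of_few_low_pairs[where G = G]) (auto simp: a_def)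
      then show "ex2_ratio \<F> n \<le> ex2_ratio \<F> m + \<eta>" by (simp add: a_def)
    qed
  qed
  have "0 < \<eta> / 2" using assms(2) by simp
  then show ?thesis
    by (rule eventually_mono[OF eventually_failure_probability_small]) (use * in blast)
qed

text \<open>
  By compactness some subsequence converges to a limit \<open>L\<close>. Late members of the subsequence, as
  \<open>n\<close>, keep \<open>r m\<close> at or above \<open>L - \<eta>\<close> for every large \<open>m\<close>; a fixed late member, as \<open>m\<close>, keeps all
  later terms below \<open>L + 2 \<eta>\<close>.
\<close>

lemma convergent_of_eventually_almost_decreasing:
  fixes r :: "nat \<Rightarrow> real"
  assumes bnd: "\<forall>\<^sub>F n in sequentially. r n \<in> {b..c}"
    and dec: "\<And>\<eta>. 0 < \<eta> \<Longrightarrow>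
      \<forall>\<^sub>F m in sequentially. \<forall>\<^sub>F n in sequentially. r n \<le> r m + \<eta>"
  shows "convergent r"
proof -
  obtain n0 where n0: "\<And>n. n0 \<le> n \<Longrightarrow> r n \<in> {b..c}"
    using bnd by (auto simp: eventually_sequentially)
  have "seq_compact {b..c}" by (simp add: compact_imp_seq_compact)
  moreover have "\<forall>n. r (n + n0) \<in> {b..c}" using n0 by simp
  ultimately obtain L \<sigma> where \<sigma>: "strict_mono \<sigma>" and lim: "((\<lambda>n. r (n + n0)) \<circ> \<sigma>) \<longlonglongrightarrow> L"
    by (rule seq_compactE) blast
  define \<tau> where "\<tau> = (\<lambda>n. \<sigma> n + n0)"
  have \<tau>: "filterlim \<tau> at_top sequentially"
    using \<sigma> unfolding \<tau>_def
    by (intro filterlim_subseq) (auto simp: strict_mono_def)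
  have lim: "(\<lambda>n. r (\<tau> n)) \<longlonglongrightarrow> L" using lim by (simp add: \<tau>_def o_def)
  have "r \<longlonglongrightarrow> L"
  proof (rule order_tendstoI)
    fix x assume x: "x < L"
    define \<eta> where "\<eta> = (L - x) / 2"
    have \<eta>: "0 < \<eta>" using x by (simp add: \<eta>_def)
    from dec[OF \<eta>] show "\<forall>\<^sub>F n in sequentially. x < r n"
    proof (rule eventually_mono)
      fix m assume "\<forall>\<^sub>F n in sequentially. r n \<le> r m + \<eta>"
      then have "\<forall>\<^sub>F n in sequentially. r (\<tau> n) \<le> r m + \<eta>"
        using \<tau> by (rule eventually_compose_filterlim)
      then have "L \<le> r m + \<eta>"
        using lim by (intro tendsto_upperbound) auto
      then show "x < r m" using x by (simp add: \<eta>_def field_simps)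
    qed
  next
    fix x assume x: "L < x"
    define \<eta> where "\<eta> = (x - L) / 2"
    have \<eta>: "0 < \<eta>" using x by (simp add: \<eta>_def)
    have "\<forall>\<^sub>F k in sequentially. \<forall>\<^sub>F n in sequentially. r n \<le> r (\<tau> k) + \<eta>"
      using dec[OF \<eta>] \<tau> by (rule eventually_compose_filterlim)
    moreover have "\<forall>\<^sub>F k in sequentially. r (\<tau> k) < L + \<eta>"
      using lim \<eta> by (intro order_tendstoD) auto
    ultimately have "\<forall>\<^sub>F k in sequentially. (\<forall>\<^sub>F n in sequentially. r n \<le> r (\<tau> k) + \<eta>) \<and> r (\<tau> k) < L + \<eta>"
      by (rule eventually_conj)
    then obtain k where k: "\<forall>\<^sub>F n in sequentially. r n \<le> r (\<tau> k) + \<eta>" "r (\<tau> k) < L + \<eta>"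
      using eventually_happens'[OF sequentially_bot] by blast
    from k(1) show "\<forall>\<^sub>F n in sequentially. r n < x"
      by (rule eventually_mono) (use k(2) in \<open>simp add: \<eta>_def field_simps\<close>)
  qed
  then show ?thesis by (auto simp: convergent_def)
qed

lemma ex2_ratio_tendsto:
  assumes "\<forall>F\<in>\<F>. nonempty_graph F"
  shows "ex2_ratio \<F> \<longlonglongrightarrow> codegree_density \<F>"
proof -
  have "\<forall>\<^sub>F n in sequentially. ex2_ratio \<F> n \<in> {0..1}"
    using ex2_ratio_bounds[OF assms] by (auto simp: eventually_sequentially intro!: exI[of _ 3])
  then have "convergent (ex2_ratio \<F>)"
    using eventually_ex2_ratio_le[OF assms] by (rule convergent_of_eventually_almost_decreasing)
  then show ?thesis
    by (simp add: codegree_density_def convergent_LIMSEQ_iff ex2_ratio_def[abs_def])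
qed

section \<open>Quasirandom graphs have few pairs of low codegree\<close>

lemma e12_verts_eq_sum_codeg:
  assumes "three_graph G" "P \<subseteq> nsets (verts G) 2"
  shows "e12 G (verts G) P = (\<Sum>S\<in>P. codeg G S)"
proof -
  have V: "finite (verts G)" using assms by (simp add: three_graph_def)
  have finP: "finite P" using assms(2) V by (meson finite_imp_finite_nsets finite_subset)
  have "{(x, S). x \<in> verts G \<and> S \<in> P \<and> {x} \<union> S \<in> edges G}
        = prod.swap ` (SIGMA S:P. {x \<in> verts G. {x} \<union> S \<in> edges G})"
    by (auto simp: image_iff)
  then have "e12 G (verts G) P = card (SIGMA S:P. {x \<in> verts G. {x} \<union> S \<in> edges G})"
    by (simp add: e12_def card_image)
  also have "\<dots> = (\<Sum>S\<in>P. card {x \<in> verts G. {x} \<union> S \<in> edges G})"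
    using finP V by (subst card_SigmaI) auto
  also have "\<dots> = (\<Sum>S\<in>P. codeg G S)"
  proof (rule sum.cong)
    fix S assume "S \<in> P"
    then obtain u v where "S = {u, v}" "u \<noteq> v" using assms(2) by (blast elim: nsets2_E)
    then show "card {x \<in> verts G. {x} \<union> S \<in> edges G} = codeg G S"
      by (simp add: codeg_eq_card_neighbours[OF assms(1)] insert_commute)
  qed simp
  finally show ?thesis .
qed

text \<open>
  Quasirandomness is applied to the full vertex set and the set \<open>P\<close> of pairs of low codegree.
  The first summand accounts for the diagonal; the factor \<open>4\<close> arises because a pair \<open>S\<close> in \<open>P\<close> is
  replaced by \<open>S \<times> S\<close>.
\<close>

lemma card_low_pairs_quasirandom:
  fixes p \<eta> \<epsilon> :: real
  assumes G: "three_graph G" and qr: "quasirandom12 p \<epsilon> G" and \<eta>: "0 < \<eta>"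
  shows "card (low_pairs ((p - \<eta>) * card (verts G)) G)
           \<le> card (verts G) + 4 * (\<epsilon> / \<eta>) * (card (verts G))\<^sup>2"
proof -
  define N where "N = real (card (verts G))"
  define d where "d = (p - \<eta>) * N"
  define P where "P = {S \<in> nsets (verts G) 2. real (codeg G S) < d}"
  have V: "finite (verts G)" using G by (simp add: three_graph_def)
  have P: "P \<subseteq> nsets (verts G) 2" by (auto simp: P_def)
  then have finP: "finite P" using V by (meson finite_imp_finite_nsets finite_subset)
  have cardP: "card P \<le> (\<epsilon> / \<eta>) * N\<^sup>2"
  proof (cases "N = 0")
    case True
    then have "P = {}" using P V by (auto simp: N_def nsets_2_eq)
    then show ?thesis using True by simp
  next
    case False
    then have N: "0 < N" by (simp add: N_def)
    have "p * N * card P - real (e12 G (verts G) P) \<le> \<epsilon> * N ^ 3"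
      using qr P unfolding quasirandom12_def N_def by (smt (verit) order_refl)
    moreover have "real (e12 G (verts G) P) \<le> d * card P"
      unfolding e12_verts_eq_sum_codeg[OF G P] of_nat_sum
      using sum_bounded_above[of P "\<lambda>S. real (codeg G S)" d] by (auto simp: P_def mult.commute)
    ultimately have "\<eta> * card P * N \<le> \<epsilon> * N\<^sup>2 * N"
      by (simp add: d_def algebra_simps power3_eq_cube power2_eq_square)
    then have "\<eta> * card P \<le> \<epsilon> * N\<^sup>2" using N by simp
    then show ?thesis using \<eta> by (simp add: field_simps)
  qed
  have "low_pairs d G \<subseteq> {(u, v). u \<in> verts G \<and> v \<in> verts G \<and> u = v} \<union> (\<Union>S\<in>P. S \<times> S)"
  proof (rule subrelI)
    fix u v assume uv: "(u, v) \<in> low_pairs d G"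
    show "(u, v) \<in> {(u, v). u \<in> verts G \<and> v \<in> verts G \<and> u = v} \<union> (\<Union>S\<in>P. S \<times> S)"
    proof (cases "u = v")
      case False
      then have "{u, v} \<in> P" using uv by (auto simp: low_pairs_def P_def)
      then show ?thesis by blast
    qed (use uv in \<open>auto simp: low_pairs_def\<close>)
  qed
  moreover have finS: "finite S" "card S = 2" if "S \<in> P" for S
    using P that by (auto simp: nsets_def)
  ultimately have "card (low_pairs d G)
      \<le> card ({(u, v). u \<in> verts G \<and> v \<in> verts G \<and> u = v} \<union> (\<Union>S\<in>P. S \<times> S))"
    using V finP by (intro card_mono) (auto intro: finite_subset[of _ "verts G \<times> verts G"])
  also have "\<dots> \<le> card (verts G) + (\<Sum>S\<in>P. card (S \<times> S))"
    by (rule order.trans[OF card_Un_le]) (simp only: card_diagonal add_left_mono card_UN_le[OF finP])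
  also have "(\<Sum>S\<in>P. card (S \<times> S)) = 4 * card P"
    using finS by (simp add: card_cartesian_product)
  finally have "real (card (low_pairs d G)) \<le> N + 4 * card P"
    by (simp add: N_def)
  also have "\<dots> \<le> N + 4 * ((\<epsilon> / \<eta>) * N\<^sup>2)" using cardP by simp
  finally show ?thesis by (simp add: d_def N_def)
qed

section \<open>Comparing the two densities\<close>

lemma quasirandom_density_le_codegree_density:
  fixes G :: "nat \<Rightarrow> nat hypergraph"
  assumes \<F>: "\<forall>F\<in>\<F>. nonempty_graph F"
    and G: "\<And>n. three_graph (G n)" and free: "\<And>n. free_of \<F> (G n)"
    and size: "filterlim (\<lambda>n. card (verts (G n))) at_top sequentially"
    and p: "qr12_with_density G p"
  shows "p \<le> codegree_density \<F>"
proof (rule ccontr)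
  let ?L = "codegree_density \<F>"
  assume "\<not> p \<le> ?L"
  \<comment> \<open>Two losses of \<open>\<eta>\<close> will occur, one in the codegrees and one in sampling; a third of the gap
    makes their sum too small to bridge it.\<close>
  define \<eta> where "\<eta> = (p - ?L) / 3"
  have \<eta>: "0 < \<eta>" using \<open>\<not> p \<le> ?L\<close> by (simp add: \<eta>_def)
  have "\<forall>\<^sub>F m in sequentially. 0 \<le> ex2_ratio \<F> m"
    using ex2_ratio_bounds[OF \<F>] by (auto simp: eventually_sequentially)
  then have "0 \<le> ?L"
    using ex2_ratio_tendsto[OF \<F>] by (intro tendsto_lowerbound) auto
  then have a: "0 \<le> p - \<eta>" "p - \<eta> \<le> 1"
    using \<eta> p by (auto simp: qr12_with_density_def \<eta>_def field_simps)
  obtain \<epsilon> where \<epsilon>: "\<epsilon> \<longlonglongrightarrow> 0" and qr: "\<And>n. quasirandom12 p (\<epsilon> n) (G n)"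
    using p by (auto simp: qr12_with_density_def)
  have "p - \<eta> - \<eta> \<le> ex2_ratio \<F> m"
    if m: "3 \<le> m" "(real m)\<^sup>2 * exp (- (\<eta>\<^sup>2 / 2) * real (m - 2)) < 1 / 2" for m
  proof -
    define \<delta> where "\<delta> = 1 / (2 * (real m)\<^sup>2)"
    have \<delta>: "0 < \<delta>" using m by (simp add: \<delta>_def)
    have "filterlim (\<lambda>n. real (card (verts (G n)))) at_top sequentially"
      using filterlim_compose[OF filterlim_real_sequentially size] .
    then have "\<forall>\<^sub>F n in sequentially. max 1 (2 / \<delta>) \<le> real (card (verts (G n)))"
      unfolding filterlim_at_top by blast
    moreover have "\<forall>\<^sub>F n in sequentially. \<epsilon> n < \<delta> * \<eta> / 8"
      using \<epsilon> \<delta> \<eta> by (intro order_tendstoD) auto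
    ultimately have "\<forall>\<^sub>F n in sequentially.
        max 1 (2 / \<delta>) \<le> real (card (verts (G n))) \<and> \<epsilon> n < \<delta> * \<eta> / 8"
      by (rule eventually_conj)
    then obtain n where N: "1 \<le> real (card (verts (G n)))" "2 / \<delta> \<le> real (card (verts (G n)))"
      and \<epsilon>n: "\<epsilon> n < \<delta> * \<eta> / 8"
      using eventually_happens'[OF sequentially_bot] by fastforce
    define N where "N = real (card (verts (G n)))"
    have "card (low_pairs ((p - \<eta>) * N) (G n)) \<le> N + 4 * (\<epsilon> n / \<eta>) * N\<^sup>2"
      using card_low_pairs_quasirandom[OF G qr \<eta>, of n] by (simp add: N_def)
    also have "\<dots> \<le> \<delta> / 2 * N\<^sup>2 + \<delta> / 2 * N\<^sup>2"
    proof (intro add_mono mult_right_mono)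
      show "N \<le> \<delta> / 2 * N\<^sup>2"
        using N \<delta> by (simp add: N_def power2_eq_square field_simps)
      show "4 * (\<epsilon> n / \<eta>) \<le> \<delta> / 2" using \<epsilon>n \<eta> by (simp add: field_simps)
    qed simp
    finally show ?thesis
      using a \<eta> m G free N unfolding \<delta>_def
      by (intro ex2_ratio_ge_of_few_low_pairs[where G = "G n"]) (auto simp: N_def)
  qed
  then have "\<forall>\<^sub>F m in sequentially. p - \<eta> - \<eta> \<le> ex2_ratio \<F> m"
    by (intro eventually_mono[OF eventually_failure_probability_small[OF \<eta>]]) auto
  then have "p - \<eta> - \<eta> \<le> ?L"
    using ex2_ratio_tendsto[OF \<F>] by (intro tendsto_lowerbound) auto
  then show False using \<eta> by (simp add: \<eta>_def field_simps)
qed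

lemma edgeless_qr12: "qr12_with_density (\<lambda>n. ({..<n}, {})) 0"
  by (auto simp: qr12_with_density_def quasirandom12_def e12_def intro!: exI[of _ "\<lambda>_. 0"])

theorem corollary6:
  fixes \<F> :: "'a hypergraph set"
  assumes "\<forall>F\<in>\<F>. three_graph F \<and> nonempty_graph F"
  shows "qr12_density \<F> \<le> codegree_density \<F>"
  unfolding qr12_density_def
proof (rule cSup_least)
  have \<F>: "\<forall>F\<in>\<F>. nonempty_graph F" using assms by blast
  let ?E = "\<lambda>n. ({..<n}, {}) :: nat hypergraph"
  have "qr12_sequence ?E"
    using edgeless_qr12 by (auto simp: qr12_sequence_def edgeless_three_graph filterlim_ident)
  then show "{seq_density G | G :: nat \<Rightarrow> nat hypergraph.
      qr12_sequence G \<and> (\<forall>n. free_of \<F> (G n))} \<noteq> {}"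
    using edgeless_free_of[OF \<F>] by blast
  fix x assume "x \<in> {seq_density G | G :: nat \<Rightarrow> nat hypergraph.
      qr12_sequence G \<and> (\<forall>n. free_of \<F> (G n))}"
  then obtain G :: "nat \<Rightarrow> nat hypergraph" where x: "x = seq_density G"
    and G: "qr12_sequence G" "\<And>n. free_of \<F> (G n)" by blast
  show "x \<le> codegree_density \<F>"
    unfolding x seq_density_def
  proof (rule cSup_least)
    show "{p. qr12_with_density G p} \<noteq> {}" using G(1) by (auto simp: qr12_sequence_def)
  qed (use G quasirandom_density_le_codegree_density[OF \<F>] in \<open>auto simp: qr12_sequence_def\<close>)
qed

end
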